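(* Let $\mathsf C$ be a complete weighted lattice (over $\mathsf Q$) and let $L:\mathsf C\to\mathsf C$ be a $\mathsf Q$-endofunctor. Then for all $p,q\in Q$, the $\mathsf Q$-categories $\mathcal S_q(L)$, $\mathcal P_p(L)$ and $\mathcal F_p^q(L)$ are complete (i.e. each admits all weighted meets and all weighted joins), and thus nonempty.
   Context: Throughout, $\mathsf Q=(Q,\preceq,\cdot,1)$ is a commutative, unital, semicartesian quantale: $(Q,\preceq)$ is a complete lattice, $\cdot$ is an associative commutative operation on $Q$ with unit $1$ that distributes over arbitrary joins in each variable, and $p\cdot q\preceq p\wedge q$ for all $p,q$ (so $1=\top$). The internal hom is $[p,q]:=\bigvee\{r\in Q: p\cdot r\preceq q\}$. A (small) $\mathsf Q$-category $\mathsf C$ is a set $\mathrm{ob}(\mathsf C)$ with elements $\hom_{\mathsf C}(x,y)\in Q$ such that $\hom_{\mathsf C}(x,x)=1$ and $\hom_{\mathsf C}(x,y)\cdot\hom_{\mathsf C}(y,z)\preceq\hom_{\mathsf C}(x,z)$ for all $x,y,z$. A $\mathsf Q$-functor $F:\mathsf C\to\mathsf D$ is a function on objects with $\hom_{\mathsf C}(x,y)\preceq\hom_{\mathsf D}(Fx,Fy)$ for all $x,y$; a $\mathsf Q$-endofunctor is a $\mathsf Q$-functor $\mathsf C\to\mathsf C$. Notation: $x\preceq_q y$ means $\hom_{\mathsf C}(x,y)\succeq q$. Given a set $\mathsf S$ and functions $S:\mathsf S\to\mathrm{ob}(\mathsf C)$, $W:\mathsf S\to Q$, the weighted meet $\bigwedge^W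 S$ is an object of $\mathsf C$ with $\hom_{\mathsf C}(x,\bigwedge^W S)=\bigwedge_{c\in\mathsf S}[W(c),\hom_{\mathsf C}(x,S(c))]$ for all $x$, and the weighted join $\bigvee^W S$ is an object with $\hom_{\mathsf C}(\bigvee^W S,x)=\bigwedge_{c\in\mathsf S}[W(c),\hom_{\mathsf C}(S(c),x)]$ for all $x$. A $\mathsf Q$-category is complete, or a (complete) weighted lattice, if it admits all weighted meets and joins. For a $\mathsf Q$-endofunctor $L$ of $\mathsf C$ and $p,q\in Q$, define full $\mathsf Q$-subcategories of $\mathsf C$ (subsets of objects, with the hom-values of $\mathsf C$): $\mathcal P_p(L)$ has objects those $x$ with $Lx\preceq_p x$ ($p$-prefix points); $\mathcal S_q(L)$ has objects those $x$ with $x\preceq_q Lx$ ($q$-suffix points); $\mathcal F_p^q(L)$ has objects those $x$ that are both $p$-prefix and $q$-suffix points. *)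

theory Defs
  imports Main
begin

class semicartesian_quantale = complete_lattice + comm_monoid_mult +
  assumes mult_Sup_distrib: "p * Sup A = (SUP a\<in>A. p * a)"
    and mult_le_inf: "p * q \<le> inf p q"
begin

lemma Sup_mult_distrib: "Sup A * p = (SUP a\<in>A. a * p)"
  using mult_Sup_distrib[of p A] by (simp add: mult.commute)

lemma one_eq_top: "1 = top"
  using mult_le_inf[of 1 top] by (simp add: top_unique)

definition ihom :: "'a \<Rightarrow> 'a \<Rightarrow> 'a"
  where "ihom p q = Sup {r. p * r \<le> q}"

lemma mult_left_le: "a \<le> b \<Longrightarrow> p * a \<le> p * b"
  using mult_Sup_distrib[of p "{a, b}"] by (simp add: sup.absorb2 le_iff_sup)

lemma le_ihom_iff: "r \<le> ihom p q \<longleftrightarrow> p * r \<le> q"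
proof
  assume "r \<le> ihom p q"
  then have "p * r \<le> p * ihom p q" by (rule mult_left_le)
  also have "\<dots> \<le> q"
    unfolding ihom_def mult_Sup_distrib by (auto intro: SUP_least)
  finally show "p * r \<le> q" .
qed (simp add: ihom_def Sup_upper)

lemma ihom_SUP: "ihom (SUP c\<in>I. f c) q = (INF c\<in>I. ihom (f c) q)"
proof (rule order.antisym)
  show "ihom (SUP c\<in>I. f c) q \<le> (INF c\<in>I. ihom (f c) q)"
  proof (rule INF_greatest)
    fix c assume "c \<in> I"
    then have "f c * r \<le> (SUP c\<in>I. f c) * r" for r
      using mult_left_le[of "f c" "SUP c\<in>I. f c" r]
      by (simp add: SUP_upper mult.commute)
    then show "ihom (SUP c\<in>I. f c) q \<le> ihom (f c) q"
      by (meson le_ihom_iff order.refl order.trans)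
  qed
  have "f c * (INF c\<in>I. ihom (f c) q) \<le> q" if "c \<in> I" for c
    unfolding le_ihom_iff[symmetric] using that by (rule INF_lower)
  then show "(INF c\<in>I. ihom (f c) q) \<le> ihom (SUP c\<in>I. f c) q"
    by (simp add: le_ihom_iff Sup_mult_distrib SUP_least image_image)
qed

end

record ('a, 'q) qcat =
  ob :: "'a set"
  hom :: "'a \<Rightarrow> 'a \<Rightarrow> 'q"

definition q_category :: "('a, 'q::semicartesian_quantale) qcat \<Rightarrow> bool"
  where "q_category C \<longleftrightarrow>
    (\<forall>x\<in>ob C. hom C x x = 1) \<and>
    (\<forall>x\<in>ob C. \<forall>y\<in>ob C. \<forall>z\<in>ob C. hom C x y * hom C y z \<le> hom C x z)"

definition q_functor ::
  "('a, 'q::semicartesian_quantale) qcat \<Rightarrow> ('b, 'q) qcat \<Rightarrow> ('a \<Rightarrow> 'b) \<Rightarrow> bool"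
  where "q_functor C D F \<longleftrightarrow>
    (\<forall>x\<in>ob C. F x \<in> ob D) \<and>
    (\<forall>x\<in>ob C. \<forall>y\<in>ob C. hom C x y \<le> hom D (F x) (F y))"

abbreviation q_endofunctor ::
  "('a, 'q::semicartesian_quantale) qcat \<Rightarrow> ('a \<Rightarrow> 'a) \<Rightarrow> bool"
  where "q_endofunctor C L \<equiv> q_functor C C L"

definition is_weighted_meet ::
  "('a, 'q::semicartesian_quantale) qcat \<Rightarrow> 'i set \<Rightarrow> ('i \<Rightarrow> 'q) \<Rightarrow> ('i \<Rightarrow> 'a) \<Rightarrow> 'a \<Rightarrow> bool"
  where "is_weighted_meet C I W S m \<longleftrightarrow>
    m \<in> ob C \<and> (\<forall>x\<in>ob C. hom C x m = (INF c\<in>I. ihom (W c) (hom C x (S c))))"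

definition is_weighted_join ::
  "('a, 'q::semicartesian_quantale) qcat \<Rightarrow> 'i set \<Rightarrow> ('i \<Rightarrow> 'q) \<Rightarrow> ('i \<Rightarrow> 'a) \<Rightarrow> 'a \<Rightarrow> bool"
  where "is_weighted_join C I W S j \<longleftrightarrow>
    j \<in> ob C \<and> (\<forall>x\<in>ob C. hom C j x = (INF c\<in>I. ihom (W c) (hom C (S c) x)))"

text \<open>
  Completeness quantifies over all index sets, which a formula cannot do across types; the
  index sets therefore range over the subsets of a type \<open>'i\<close> passed as an argument. Nothing is
  lost by taking the type of objects for \<open>'i\<close>: lemma \<open>weighted_lattice_any_index\<close> below derives
  completeness for index sets of every type from that case.
\<close>

definition weighted_lattice ::
  "'i itself \<Rightarrow> ('a, 'q::semicartesian_quantale) qcat \<Rightarrow> bool"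
  where "weighted_lattice (_ :: 'i itself) C \<longleftrightarrow>
    q_category C \<and>
    (\<forall>(I :: 'i set) W S. (\<forall>c\<in>I. S c \<in> ob C) \<longrightarrow>
      (\<exists>m. is_weighted_meet C I W S m) \<and> (\<exists>j. is_weighted_join C I W S j))"

lemma INF_ihom_reindex:
  fixes W :: "'i \<Rightarrow> 'q::semicartesian_quantale"
  shows "(INF x\<in>S ` I. ihom (SUP c\<in>{c\<in>I. S c = x}. W c) (h x)) = (INF c\<in>I. ihom (W c) (h (S c)))"
  unfolding ihom_SUP
  by (rule order.antisym) (force intro!: INF_greatest intro: INF_lower2)+

lemma weighted_lattice_any_index:
  fixes C :: "('a, 'q::semicartesian_quantale) qcat"
  assumes "weighted_lattice TYPE('a) C"
  shows "weighted_lattice TYPE('i) C"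
  unfolding weighted_lattice_def
proof (intro conjI allI impI)
  show "q_category C"
    using assms by (simp add: weighted_lattice_def)
next
  fix I :: "'i set" and W :: "'i \<Rightarrow> 'q" and S :: "'i \<Rightarrow> 'a"
  assume S: "\<forall>c\<in>I. S c \<in> ob C"
  define V where "V x = (SUP c\<in>{c\<in>I. S c = x}. W c)" for x
  have "\<forall>x\<in>S ` I. (\<lambda>x. x) x \<in> ob C"
    using S by auto
  then obtain m j where m: "is_weighted_meet C (S ` I) V (\<lambda>x. x) m"
    and j: "is_weighted_join C (S ` I) V (\<lambda>x. x) j"
    using assms unfolding weighted_lattice_def by metis
  show "\<exists>m. is_weighted_meet C I W S m"
    using m INF_ihom_reindex[where S = S and I = I and W = W and h = "hom C x" for x]
    unfolding is_weighted_meet_def V_def by auto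
  show "\<exists>j. is_weighted_join C I W S j"
    using j INF_ihom_reindex[where S = S and I = I and W = W and h = "\<lambda>y. hom C y x" for x]
    unfolding is_weighted_join_def V_def by auto
qed

definition full_subcategory :: "('a, 'q) qcat \<Rightarrow> 'a set \<Rightarrow> ('a, 'q) qcat"
  where "full_subcategory C A = \<lparr>ob = A, hom = hom C\<rparr>"

definition q_le :: "('a, 'q::semicartesian_quantale) qcat \<Rightarrow> 'q \<Rightarrow> 'a \<Rightarrow> 'a \<Rightarrow> bool"
  where "q_le C q x y \<longleftrightarrow> hom C x y \<ge> q"

definition prefix_points ::
  "('a, 'q::semicartesian_quantale) qcat \<Rightarrow> 'q \<Rightarrow> ('a \<Rightarrow> 'a) \<Rightarrow> ('a, 'q) qcat"
  where "prefix_points C p L = full_subcategory C {x \<in> ob C. q_le C p (L x) x}"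

definition suffix_points ::
  "('a, 'q::semicartesian_quantale) qcat \<Rightarrow> 'q \<Rightarrow> ('a \<Rightarrow> 'a) \<Rightarrow> ('a, 'q) qcat"
  where "suffix_points C q L = full_subcategory C {x \<in> ob C. q_le C q x (L x)}"

definition fixed_points ::
  "('a, 'q::semicartesian_quantale) qcat \<Rightarrow> 'q \<Rightarrow> 'q \<Rightarrow> ('a \<Rightarrow> 'a) \<Rightarrow> ('a, 'q) qcat"
  where "fixed_points C p q L =
    full_subcategory C {x \<in> ob C. q_le C p (L x) x \<and> q_le C q x (L x)}"

end

theory Submission
  imports Defs
begin

text \<open>
  The \<open>q\<close>-suffix points are closed under the weighted joins of \<open>C\<close>, and a \<open>Q\<close>-category with all
  weighted joins has all weighted meets: the meet of \<open>S\<close> weighted by \<open>W\<close> is the join of all objects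
  \<open>x\<close>, each weighted by the degree to which \<open>x\<close> is a lower bound of \<open>S\<close>. Prefix points are the
  suffix points of the opposite category. Finally, \<open>L\<close> restricts to the complete category of
  \<open>q\<close>-suffix points, and its \<open>p\<close>-prefix points there are exactly the points that are both
  \<open>p\<close>-prefix and \<open>q\<close>-suffix.
\<close>

lemma mult_mono_quantale:
  fixes a b c d :: "'q::semicartesian_quantale"
  assumes "a \<le> b" and "c \<le> d"
  shows "a * c \<le> b * d"
proof -
  have "a * c \<le> a * d"
    using assms(2) by (rule mult_left_le)
  also have "\<dots> \<le> b * d"
    using mult_left_le[OF assms(1), of d] by (simp add: mult.commute)
  finally show ?thesis .
qed

lemma hom_comp_le:
  assumes "q_category C" "x \<in> ob C" "y \<in> ob C" "z \<in> ob C"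
    and "a \<le> hom C x y" "b \<le> hom C y z"
  shows "a * b \<le> hom C x z"
proof -
  have "a * b \<le> hom C x y * hom C y z"
    using assms(5,6) by (rule mult_mono_quantale)
  also have "\<dots> \<le> hom C x z"
    using assms(1-4) by (simp add: q_category_def)
  finally show ?thesis .
qed

lemma q_category_full_subcategory:
  assumes "q_category C" "A \<subseteq> ob C"
  shows "q_category (full_subcategory C A)"
  using assms unfolding q_category_def full_subcategory_def by (simp add: subset_iff)

text \<open>The empty family already has a weighted meet, and that meet is an object. Its weights
  and values are arbitrary, since the index set is empty.\<close>

lemma weighted_lattice_nonempty:
  fixes C :: "('a, 'q::semicartesian_quantale) qcat"
  assumes "weighted_lattice TYPE('i) C"
  shows "ob C \<noteq> {}"
proof -
  have "\<exists>m. is_weighted_meet C ({} :: 'i set) (\<lambda>_. 1) (\<lambda>_. undefined) m"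
    using assms unfolding weighted_lattice_def by blast
  then show ?thesis
    by (auto simp: is_weighted_meet_def)
qed

lemma is_weighted_join_lower_bounds:
  assumes C: "q_category C" and S: "\<forall>c\<in>I. S c \<in> ob C"
    and m: "is_weighted_join C (ob C) (\<lambda>x. INF c\<in>I. ihom (W c) (hom C x (S c))) (\<lambda>x. x) m"
  shows "is_weighted_meet C I W S m"
  unfolding is_weighted_meet_def
proof (intro conjI ballI)
  let ?V = "\<lambda>x. INF c\<in>I. ihom (W c) (hom C x (S c))"
  show m_ob: "m \<in> ob C"
    using m by (simp add: is_weighted_join_def)
  have hom_m: "hom C m y = (INF x\<in>ob C. ihom (?V x) (hom C x y))" if "y \<in> ob C" for y
    using m that by (simp add: is_weighted_join_def)
  fix y assume y: "y \<in> ob C"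
  show "hom C y m = ?V y"
  proof (rule order.antisym)
    show "hom C y m \<le> ?V y"
    proof (rule INF_greatest)
      fix c assume c: "c \<in> I"
      \<comment> \<open>The join formula at \<open>S c\<close> reduces this to a bound for each
        \<open>x\<close>; by commutativity \<open>W c\<close> and \<open>?V x\<close> trade places,
        and the bound says that \<open>?V x\<close> lies below its own factor at
        \<open>c\<close>.\<close>
      have "W c \<le> hom C m (S c)"
        unfolding hom_m[OF S[rule_format, OF c]]
      proof (rule INF_greatest)
        fix x
        have "?V x \<le> ihom (W c) (hom C x (S c))"
          using c by (rule INF_lower)
        then show "W c \<le> ihom (?V x) (hom C x (S c))"
          by (simp add: le_ihom_iff mult.commute)
      qed
      then have "hom C y m * W c \<le> hom C y (S c)"
        using hom_comp_le[OF C y m_ob] S c by blast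
      then show "hom C y m \<le> ihom (W c) (hom C y (S c))"
        by (simp add: le_ihom_iff mult.commute)
    qed
    \<comment> \<open>The join formula is evaluated at \<open>m\<close> itself, where the hom-value
      is the unit; the factor at \<open>x = y\<close> then gives the bound.\<close>
    have "1 \<le> (INF x\<in>ob C. ihom (?V x) (hom C x m))"
      using C m_ob hom_m[OF m_ob] by (simp add: q_category_def)
    also have "\<dots> \<le> ihom (?V y) (hom C y m)"
      using y by (rule INF_lower)
    finally show "?V y \<le> hom C y m"
      by (simp add: le_ihom_iff)
  qed
qed

text \<open>The join that yields a meet is indexed by the objects themselves, so joins over index
  sets in the type of objects suffice.\<close>

lemma weighted_latticeI_joins:
  fixes C :: "('a, 'q::semicartesian_quantale) qcat"
  assumes "q_category C"
    and "\<And>(I :: 'a set) W S. \<forall>c\<in>I. S c \<in> ob C \<Longrightarrow> \<exists>j. is_weighted_join C I W S j"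
  shows "weighted_lattice TYPE('a) C"
proof -
  have "\<exists>m. is_weighted_meet C I W S m" if "\<forall>c\<in>I. S c \<in> ob C" for I :: "'a set" and W S
    using is_weighted_join_lower_bounds[OF assms(1) that] assms(2)[of "ob C" "\<lambda>x. x"] by blast
  then show ?thesis
    using assms unfolding weighted_lattice_def by blast
qed

lemma ob_suffix_points: "x \<in> ob (suffix_points C q L) \<longleftrightarrow> x \<in> ob C \<and> q \<le> hom C x (L x)"
  by (simp add: suffix_points_def full_subcategory_def q_le_def)

lemma hom_suffix_points [simp]: "hom (suffix_points C q L) = hom C"
  by (simp add: suffix_points_def full_subcategory_def)

text \<open>Each \<open>S c\<close> lies below \<open>j\<close> to degree \<open>W c\<close>.
  Applying \<open>L\<close> and composing with the \<open>q\<close>-suffix inequality of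
  \<open>S c\<close> puts \<open>S c\<close> below \<open>L j\<close> to degree
  \<open>q * W c\<close>; the universal property of \<open>j\<close> then turns these bounds into
  \<open>q \<le> hom C j (L j)\<close>.\<close>

lemma suffix_point_weighted_join:
  assumes C: "q_category C" and L: "q_endofunctor C L"
    and S: "\<forall>c\<in>I. S c \<in> ob (suffix_points C q L)"
    and j: "is_weighted_join C I W S j"
  shows "j \<in> ob (suffix_points C q L)"
proof -
  have j_ob: "j \<in> ob C"
    using j by (simp add: is_weighted_join_def)
  have L_ob: "L x \<in> ob C" if "x \<in> ob C" for x
    using L that by (simp add: q_functor_def)
  have "q \<le> ihom (W c) (hom C (S c) (L j))" if c: "c \<in> I" for c
  proof -
    have Sc: "S c \<in> ob C" "q \<le> hom C (S c) (L (S c))"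
      using S c by (simp_all add: ob_suffix_points)
    have "1 \<le> hom C j j"
      using C j_ob by (simp add: q_category_def)
    also have "\<dots> \<le> ihom (W c) (hom C (S c) j)"
      using j j_ob INF_lower[OF c] by (simp add: is_weighted_join_def)
    finally have "W c \<le> hom C (S c) j"
      by (simp add: le_ihom_iff)
    also have "\<dots> \<le> hom C (L (S c)) (L j)"
      using L Sc j_ob by (simp add: q_functor_def)
    finally have "q * W c \<le> hom C (S c) (L j)"
      using hom_comp_le[OF C Sc(1) L_ob[OF Sc(1)] L_ob[OF j_ob] Sc(2)] by blast
    then show ?thesis
      by (simp add: le_ihom_iff mult.commute)
  qed
  then have "q \<le> hom C j (L j)"
    using j L_ob[OF j_ob] by (simp add: is_weighted_join_def INF_greatest)
  with j_ob show ?thesis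
    by (simp add: ob_suffix_points)
qed

lemma weighted_lattice_suffix_points:
  fixes C :: "('a, 'q::semicartesian_quantale) qcat"
  assumes wl: "weighted_lattice TYPE('a) C" and L: "q_endofunctor C L"
  shows "weighted_lattice TYPE('a) (suffix_points C q L)"
proof (rule weighted_latticeI_joins)
  have C: "q_category C"
    using wl by (simp add: weighted_lattice_def)
  then show "q_category (suffix_points C q L)"
    unfolding suffix_points_def by (rule q_category_full_subcategory) auto
  fix I :: "'a set" and W S
  assume S: "\<forall>c\<in>I. S c \<in> ob (suffix_points C q L)"
  then obtain j where j: "is_weighted_join C I W S j"
    using wl unfolding weighted_lattice_def by (metis ob_suffix_points)
  \<comment> \<open>The subcategory is full, so the join formula of \<open>C\<close> restricts to it
    once \<open>j\<close> is known to be one of its objects.\<close>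
  then have "is_weighted_join (suffix_points C q L) I W S j"
    using suffix_point_weighted_join[OF C L S j]
    by (simp add: is_weighted_join_def ob_suffix_points)
  then show "\<exists>j. is_weighted_join (suffix_points C q L) I W S j" ..
qed

definition op_qcat :: "('a, 'q) qcat \<Rightarrow> ('a, 'q) qcat"
  where "op_qcat C = \<lparr>ob = ob C, hom = \<lambda>x y. hom C y x\<rparr>"

lemma op_qcat_simps [simp]: "ob (op_qcat C) = ob C" "hom (op_qcat C) x y = hom C y x"
  by (simp_all add: op_qcat_def)

lemma q_category_op:
  assumes "q_category C"
  shows "q_category (op_qcat C)"
proof -
  have "hom C y x * hom C z y \<le> hom C z x" if "x \<in> ob C" "y \<in> ob C" "z \<in> ob C" for x y z
    using hom_comp_le[OF assms that(3,2,1) order.refl order.refl] by (simp add: mult.commute)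
  then show ?thesis
    using assms by (simp add: q_category_def)
qed

lemma q_endofunctor_op: "q_endofunctor C L \<Longrightarrow> q_endofunctor (op_qcat C) L"
  by (simp add: q_functor_def)

lemma is_weighted_meet_op [simp]: "is_weighted_meet (op_qcat C) = is_weighted_join C"
  by (intro ext) (simp add: is_weighted_meet_def is_weighted_join_def)

lemma is_weighted_join_op [simp]: "is_weighted_join (op_qcat C) = is_weighted_meet C"
  by (intro ext) (simp add: is_weighted_meet_def is_weighted_join_def)

text \<open>Passing to the opposite exchanges weighted meets and joins, so completeness is
  self-dual.\<close>

lemma weighted_lattice_op:
  assumes "weighted_lattice TYPE('i) C"
  shows "weighted_lattice TYPE('i) (op_qcat C)"
  using assms q_category_op[of C] unfolding weighted_lattice_def by simp

lemma prefix_points_eq_op: "prefix_points C p L = op_qcat (suffix_points (op_qcat C) p L)"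
  by (simp add: prefix_points_def suffix_points_def full_subcategory_def q_le_def op_qcat_def)

lemma weighted_lattice_prefix_points:
  fixes C :: "('a, 'q::semicartesian_quantale) qcat"
  assumes "weighted_lattice TYPE('a) C" and "q_endofunctor C L"
  shows "weighted_lattice TYPE('a) (prefix_points C p L)"
  unfolding prefix_points_eq_op
  by (intro weighted_lattice_op weighted_lattice_suffix_points q_endofunctor_op assms)

text \<open>\<open>L\<close> maps suffix points to suffix points because
  \<open>q \<le> hom C x (L x) \<le> hom C (L x) (L (L x))\<close>.\<close>

lemma q_endofunctor_suffix_points:
  assumes "q_endofunctor C L"
  shows "q_endofunctor (suffix_points C q L) L"
  using assms unfolding q_functor_def by (auto simp: ob_suffix_points intro: order.trans)

lemma fixed_points_eq: "fixed_points C p q L = prefix_points (suffix_points C q L) p L"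
  by (auto simp: fixed_points_def prefix_points_def suffix_points_def full_subcategory_def q_le_def)

theorem theorem2p17:
  fixes C :: "('a, 'q::semicartesian_quantale) qcat"
    and L :: "'a \<Rightarrow> 'a"
    and p q :: 'q
  assumes "weighted_lattice TYPE('a) C"
    and "q_endofunctor C L"
  shows "weighted_lattice TYPE('i) (suffix_points C q L) \<and> ob (suffix_points C q L) \<noteq> {} \<and>
    weighted_lattice TYPE('i) (prefix_points C p L) \<and> ob (prefix_points C p L) \<noteq> {} \<and>
    weighted_lattice TYPE('i) (fixed_points C p q L) \<and> ob (fixed_points C p q L) \<noteq> {}"
proof -
  have "weighted_lattice TYPE('a) (suffix_points C q L)"
    using assms by (rule weighted_lattice_suffix_points)
  moreover have "weighted_lattice TYPE('a) (prefix_points C p L)"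
    using assms by (rule weighted_lattice_prefix_points)
  moreover have "weighted_lattice TYPE('a) (fixed_points C p q L)"
    unfolding fixed_points_eq
    by (intro weighted_lattice_prefix_points weighted_lattice_suffix_points
        q_endofunctor_suffix_points assms)
  \<comment> \<open>Completeness has been obtained for index sets of objects; reindexing carries it
    to the arbitrary index type \<open>'i\<close>.\<close>
  ultimately show ?thesis
    using weighted_lattice_any_index weighted_lattice_nonempty by blast
qed

end
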